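(* For every $n\ge4$ there exists a non-flat homogeneous Riemannian manifold $(M^n,g)$ such that $$\Vert\mathrm W(g)\Vert_g\ \ge\ \sqrt{\tfrac{n-4}{n-3}}\cdot\Vert\mathrm{Rm}(g)\Vert_g .$$
   Context: A connected Riemannian manifold is homogeneous if its isometry group acts transitively. In dimension $n\ge4$ the curvature operator $\mathrm{Rm}:\Lambda^2TM\to\Lambda^2TM$ decomposes orthogonally as $\mathrm{Rm}=\mathrm{Rm}_I+\mathrm{Rm}_{\mathrm{Ric}_0}+\mathrm W$ into the scalar part, the traceless Ricci part and the Weyl part $\mathrm W$. Norms are pointwise norms of curvature operators, normalized so that $\Vert\mathrm{Rm}_I\Vert^2=\frac{\mathrm{scal}^2}{2n(n-1)}$ and $\Vert\mathrm{Rm}_{\mathrm{Ric}_0}\Vert^2=\frac{\Vert\mathrm{Ric}_0\Vert^2}{n-2}$; on a homogeneous manifold they are constant functions. *)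

theory Defs
  imports "HOL-Analysis.Analysis"
begin

section \<open>Smooth maps between Euclidean spaces\<close>

text \<open>Only meant for open sets \<open>S\<close>: all iterated directional derivatives exist and are continuous.\<close>

fun times_differentiable_on ::
  "nat \<Rightarrow> 'a::real_normed_vector set \<Rightarrow> ('a \<Rightarrow> 'b::real_normed_vector) \<Rightarrow> bool" where
  "times_differentiable_on 0 S f \<longleftrightarrow> continuous_on S f"
| "times_differentiable_on (Suc k) S f \<longleftrightarrow>
     (\<forall>x\<in>S. f differentiable at x) \<and>
     (\<forall>v. times_differentiable_on k S (\<lambda>x. frechet_derivative f (at x) v))"

definition smooth_on :: "'a::real_normed_vector set \<Rightarrow> ('a \<Rightarrow> 'b::real_normed_vector) \<Rightarrow> bool" where
  "smooth_on S f \<longleftrightarrow> (\<forall>k. times_differentiable_on k S f)"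


section \<open>Riemannian manifolds\<close>

text \<open>
  A chart is a pair of its domain and its coordinate map (of which only the values on the domain
  matter). The metric is recorded through its coordinate expressions: \<open>metric_in M c x\<close> is the
  matrix \<open>(g_ij)\<close> of \<open>g\<close> in the chart \<open>c\<close> at the coordinate point
  \<open>x\<close>. The atlas need not be maximal; it determines the smooth structure.
\<close>

type_synonym ('a, 'n) chart = "'a set \<times> ('a \<Rightarrow> real^'n)"

record ('a, 'n::finite) manifold_data =
  space_of :: "'a topology"
  atlas :: "('a, 'n) chart set"
  metric_in :: "('a, 'n) chart \<Rightarrow> real^'n \<Rightarrow> real^'n^'n"

abbreviation points :: "('a, 'n::finite) manifold_data \<Rightarrow> 'a set" where
  "points M \<equiv> topspace (space_of M)"

abbreviation chart_dom :: "('a, 'n::finite) chart \<Rightarrow> 'a set" where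
  "chart_dom c \<equiv> fst c"

abbreviation chart_map :: "('a, 'n::finite) chart \<Rightarrow> 'a \<Rightarrow> real^'n" where
  "chart_map c \<equiv> snd c"

definition param :: "('a, 'n::finite) chart \<Rightarrow> real^'n \<Rightarrow> 'a" where
  "param c = inv_into (chart_dom c) (chart_map c)"

definition chart_on :: "'a topology \<Rightarrow> ('a, 'n::finite) chart \<Rightarrow> bool" where
  "chart_on X c \<longleftrightarrow>
     openin X (chart_dom c) \<and> open (chart_map c ` chart_dom c) \<and>
     homeomorphic_map (subtopology X (chart_dom c)) (top_of_set (chart_map c ` chart_dom c)) (chart_map c)"

text \<open>The coordinate expression of a map \<open>F\<close> and the open set on which it is defined.\<close>

definition local_rep ::
  "('a \<Rightarrow> 'a) \<Rightarrow> ('a, 'n::finite) chart \<Rightarrow> ('a, 'n) chart \<Rightarrow> real^'n \<Rightarrow> real^'n" where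
  "local_rep F c d = chart_map d \<circ> F \<circ> param c"

definition local_dom ::
  "('a \<Rightarrow> 'a) \<Rightarrow> ('a, 'n::finite) chart \<Rightarrow> ('a, 'n) chart \<Rightarrow> (real^'n) set" where
  "local_dom F c d = chart_map c ` {p \<in> chart_dom c. F p \<in> chart_dom d}"

definition smooth_manifold :: "('a, 'n::finite) manifold_data \<Rightarrow> bool" where
  "smooth_manifold M \<longleftrightarrow>
     Hausdorff_space (space_of M) \<and> second_countable (space_of M) \<and>
     (\<forall>c\<in>atlas M. chart_on (space_of M) c) \<and> (\<Union>c\<in>atlas M. chart_dom c) = points M \<and>
     (\<forall>c\<in>atlas M. \<forall>d\<in>atlas M. smooth_on (local_dom id c d) (local_rep id c d))"

definition pullback_form ::
  "(real^'n \<Rightarrow> real^'n) \<Rightarrow> (real^'n \<Rightarrow> real^'n^'n) \<Rightarrow> real^'n \<Rightarrow> real^'n^'n" where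
  "pullback_form f G x =
     (let J = matrix (frechet_derivative f (at x)) in transpose J ** G (f x) ** J)"

definition preserves_metric ::
  "('a, 'n::finite) manifold_data \<Rightarrow> ('a \<Rightarrow> 'a) \<Rightarrow> bool" where
  "preserves_metric M F \<longleftrightarrow>
     (\<forall>c\<in>atlas M. \<forall>d\<in>atlas M. \<forall>x\<in>local_dom F c d.
        pullback_form (local_rep F c d) (metric_in M d) x = metric_in M c x)"

text \<open>For \<open>F = id\<close>, \<^const>\<open>preserves_metric\<close> is the transformation law making the
  coordinate expressions a well-defined tensor field.\<close>

definition riemannian_manifold :: "('a, 'n::finite) manifold_data \<Rightarrow> bool" where
  "riemannian_manifold M \<longleftrightarrow>
     smooth_manifold M \<and>
     (\<forall>c\<in>atlas M. smooth_on (chart_map c ` chart_dom c) (metric_in M c)) \<and>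
     (\<forall>c\<in>atlas M. \<forall>x\<in>chart_map c ` chart_dom c.
        transpose (metric_in M c x) = metric_in M c x \<and>
        (\<forall>v. v \<noteq> 0 \<longrightarrow> v \<bullet> (metric_in M c x *v v) > 0)) \<and>
     preserves_metric M id"

definition smooth_map :: "('a, 'n::finite) manifold_data \<Rightarrow> ('a \<Rightarrow> 'a) \<Rightarrow> bool" where
  "smooth_map M F \<longleftrightarrow>
     continuous_map (space_of M) (space_of M) F \<and>
     (\<forall>c\<in>atlas M. \<forall>d\<in>atlas M. smooth_on (local_dom F c d) (local_rep F c d))"

definition isometries :: "('a, 'n::finite) manifold_data \<Rightarrow> ('a \<Rightarrow> 'a) set" where
  "isometries M =
     {F. bij_betw F (points M) (points M) \<and> smooth_map M F \<and>
         smooth_map M (inv_into (points M) F) \<and> preserves_metric M F}"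

definition homogeneous :: "('a, 'n::finite) manifold_data \<Rightarrow> bool" where
  "homogeneous M \<longleftrightarrow>
     connected_space (space_of M) \<and>
     (\<forall>p\<in>points M. \<forall>q\<in>points M. \<exists>F\<in>isometries M. F p = q)"


section \<open>Curvature in coordinates\<close>

text \<open>In this section \<open>G\<close> is the coordinate expression of a metric near \<open>x\<close>.\<close>

definition coord_deriv :: "'n \<Rightarrow> (real^'n \<Rightarrow> real) \<Rightarrow> real^'n \<Rightarrow> real" where
  "coord_deriv i f x = frechet_derivative f (at x) (axis i 1)"

text \<open>\<open>christoffel G k i j\<close> is \<open>\<Gamma>^k_ij\<close>.\<close>

definition christoffel ::
  "(real^'n \<Rightarrow> real^'n^'n) \<Rightarrow> 'n \<Rightarrow> 'n \<Rightarrow> 'n \<Rightarrow> real^'n \<Rightarrow> real" where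
  "christoffel G k i j x =
     (1/2) * (\<Sum>l\<in>UNIV. matrix_inv (G x) $ k $ l *
       (coord_deriv i (\<lambda>y. G y $ j $ l) x + coord_deriv j (\<lambda>y. G y $ i $ l) x
        - coord_deriv l (\<lambda>y. G y $ i $ j) x))"

text \<open>
  \<open>riemann G i j k l\<close> is the \<open>l\<close>-th component of \<open>R(\<partial>_i, \<partial>_j) \<partial>_k\<close>, where
  \<open>R(X,Y)Z = \<nabla>_X \<nabla>_Y Z - \<nabla>_Y \<nabla>_X Z - \<nabla>_[X,Y] Z\<close>.
\<close>

definition riemann ::
  "(real^'n \<Rightarrow> real^'n^'n) \<Rightarrow> 'n \<Rightarrow> 'n \<Rightarrow> 'n \<Rightarrow> 'n \<Rightarrow> real^'n \<Rightarrow> real" where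
  "riemann G i j k l x =
     coord_deriv i (christoffel G l j k) x - coord_deriv j (christoffel G l i k) x
     + (\<Sum>m\<in>UNIV. christoffel G m j k x * christoffel G l i m x
                  - christoffel G m i k x * christoffel G l j m x)"

text \<open>The Ricci tensor as an endomorphism of the tangent space, i.e. with one index raised;
  \<open>Ric(Y,Z)\<close> is the trace of \<open>X \<mapsto> R(X,Y)Z\<close>.\<close>

definition ricci :: "(real^'n \<Rightarrow> real^'n^'n) \<Rightarrow> real^'n \<Rightarrow> real^'n^'n" where
  "ricci G x = matrix_inv (G x) ** (\<chi> j k. \<Sum>i\<in>UNIV. riemann G i j k i x)"

definition scal :: "(real^'n \<Rightarrow> real^'n^'n) \<Rightarrow> real^'n \<Rightarrow> real" where
  "scal G x = trace (ricci G x)"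

definition ricci0 :: "(real^'n \<Rightarrow> real^'n^'n) \<Rightarrow> real^'n \<Rightarrow> real^'n^'n" where
  "ricci0 G x = ricci G x - (scal G x / real CARD('n)) *\<^sub>R mat 1"


section \<open>The curvature operator and its parts\<close>

text \<open>
  A bivector \<open>\<omega>\<close> is represented by the antisymmetric matrix of its components in
  \<open>\<omega> = (\<Sum>i j. \<omega>^ij \<partial>_i \<otimes> \<partial>_j)\<close>, with
  \<open>v \<and> w = v \<otimes> w - w \<otimes> v\<close>.
\<close>

definition wedge :: "real^'n \<Rightarrow> real^'n \<Rightarrow> real^'n^'n" where
  "wedge v w = (\<chi> i j. v $ i * w $ j - w $ i * v $ j)"

text \<open>For the metric \<open>g\<close> at a point, the inner product of bivectors for which
  \<open>e_i \<and> e_j\<close>, \<open>i < j\<close>, is orthonormal whenever the \<open>e_i\<close> are.\<close>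

definition bivector_inner :: "real^'n^'n \<Rightarrow> real^'n^'n \<Rightarrow> real^'n^'n \<Rightarrow> real" where
  "bivector_inner g \<omega> \<eta> =
     (1/2) * (\<Sum>i\<in>UNIV. \<Sum>j\<in>UNIV. \<Sum>k\<in>UNIV. \<Sum>l\<in>UNIV.
       g $ i $ k * g $ j $ l * \<omega> $ i $ j * \<eta> $ k $ l)"

text \<open>
  The Hilbert--Schmidt norm of an operator on bivectors. For an orthonormal frame the sum under the
  root is \<open>(1/2) * (\<Sum>i j. |T (e_i \<and> e_j)|^2)\<close>, i.e. the sum of \<open>|T (e_i \<and> e_j)|^2\<close>
  over \<open>i < j\<close>.
\<close>

definition op_norm :: "real^'n^'n \<Rightarrow> (real^'n^'n \<Rightarrow> real^'n^'n) \<Rightarrow> real" where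
  "op_norm g T =
     sqrt ((1/2) * (\<Sum>i\<in>UNIV. \<Sum>j\<in>UNIV. \<Sum>k\<in>UNIV. \<Sum>l\<in>UNIV.
       matrix_inv g $ i $ k * matrix_inv g $ j $ l *
       bivector_inner g (T (wedge (axis i 1) (axis j 1))) (T (wedge (axis k 1) (axis l 1)))))"

text \<open>
  The curvature operator is given by
  \<open>\<langle>Rm (X \<and> Y), Z \<and> V\<rangle> = \<langle>R(X,Y)V, Z\<rangle>\<close>; it is the identity on the unit sphere.
\<close>

definition Rm :: "(real^'n \<Rightarrow> real^'n^'n) \<Rightarrow> real^'n \<Rightarrow> real^'n^'n \<Rightarrow> real^'n^'n" where
  "Rm G x \<omega> =
     (\<chi> a b. (1/2) * (\<Sum>i\<in>UNIV. \<Sum>j\<in>UNIV. \<Sum>k\<in>UNIV.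
        \<omega> $ i $ j * matrix_inv (G x) $ b $ k * riemann G i j k a x))"

definition Rm_I :: "(real^'n \<Rightarrow> real^'n^'n) \<Rightarrow> real^'n \<Rightarrow> real^'n^'n \<Rightarrow> real^'n^'n" where
  "Rm_I G x \<omega> = (scal G x / (real CARD('n) * (real CARD('n) - 1))) *\<^sub>R \<omega>"

text \<open>
  \<open>X \<and> Y \<mapsto> (1 / (n - 2)) (Ric_0 X \<and> Y + X \<and> Ric_0 Y)\<close>: the Kulkarni--Nomizu product of
  \<open>Ric_0 / (n - 2)\<close> with \<open>g\<close>.
\<close>

definition Rm_Ric0 :: "(real^'n \<Rightarrow> real^'n^'n) \<Rightarrow> real^'n \<Rightarrow> real^'n^'n \<Rightarrow> real^'n^'n" where
  "Rm_Ric0 G x \<omega> =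
     (1 / (real CARD('n) - 2)) *\<^sub>R (ricci0 G x ** \<omega> + \<omega> ** transpose (ricci0 G x))"

definition Weyl :: "(real^'n \<Rightarrow> real^'n^'n) \<Rightarrow> real^'n \<Rightarrow> real^'n^'n \<Rightarrow> real^'n^'n" where
  "Weyl G x \<omega> = Rm G x \<omega> - Rm_I G x \<omega> - Rm_Ric0 G x \<omega>"

definition flat :: "('a, 'n::finite) manifold_data \<Rightarrow> bool" where
  "flat M \<longleftrightarrow>
     (\<forall>c\<in>atlas M. \<forall>x\<in>chart_map c ` chart_dom c. \<forall>i j k l. riemann (metric_in M c) i j k l x = 0)"

end

theory Submission
  imports Defs
begin

text \<open>
  The manifold is a Riemannian product of \<open>m/2\<close> hyperbolic planes of curvature \<open>-1\<close>,
  times a line if \<open>n\<close> is odd, so that \<open>m\<close> is \<open>n\<close> or \<open>n - 1\<close>. The curvature operator of such a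
  product is diagonal on coordinate bivectors: its eigenvalue is \<open>-1\<close> on the \<open>m/2\<close> bivectors
  tangent to a factor and \<open>0\<close> on all others. The Ricci tensor is \<open>-1\<close> on the planes and \<open>0\<close> on
  the line, so the trace parts are diagonal on the same bivectors, but spread over many
  of them; subtracting them changes the large eigenvalues only slightly. The Weyl part has eigenvalue \<open>-1 + 1/(m - 1)\<close> on the bivectors tangent to a factor, \<open>1/(m - 1)\<close> on the other
  bivectors spanned by directions of the planes, and \<open>0\<close> on bivectors involving the line (the
  Weyl tensor does not see the line because the scalar and the traceless Ricci contributions cancel
  there). Summing squares gives \<open>|Rm|^2 = m/2\<close> and \<open>|W|^2 = (m/2) (m - 2)/(m - 1)\<close>, hence
  \<open>|W|^2 / |Rm|^2 = 1 - 1/(m - 1) \<ge> 1 - 1/(n - 2) \<ge> (n - 4)/(n - 3)\<close>.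

  Hyperbolic planes are preferred to spheres because the product is then covered by one chart: the
  plane is \<open>\<real>\<^sup>2\<close> with the metric \<open>dt^2 + exp (2 t) dy^2\<close>, a left-invariant metric on the group of
  affine maps of the line. The metric is diagonal in these coordinates, and its left translations
  are affine maps of \<open>\<real>\<^sup>2\<close> that act transitively. The lemmas \<open>riemann_metric\<close>,
  \<open>Weyl_metric\<close>, \<open>norm_Weyl\<close> and \<open>homogeneous_half_planes\<close> carry the argument.
\<close>

section \<open>Smoothness and componentwise derivatives\<close>

lemma times_differentiable_on_const:
  "times_differentiable_on k S (\<lambda>x. c)"
proof (induction k arbitrary: c)
  case 0
  then show ?case by simp
next
  case (Suc k)
  then show ?case by simp
qed

lemma smooth_on_if_constant_derivative:
  fixes f :: "'a::real_normed_vector \<Rightarrow> 'b::real_normed_vector"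
  assumes f: "\<And>x. (f has_derivative L) (at x)"
  shows "smooth_on S f"
  unfolding smooth_on_def
proof
  fix k
  have d: "frechet_derivative f (at x) = L" for x
    using frechet_derivative_at[OF f[of x]] by simp
  have c: "continuous_on S f"
    using has_derivative_continuous[OF f] by (simp add: continuous_at_imp_continuous_on)
  have D: "f differentiable at x" for x
    by (rule differentiableI[OF f])
  show "times_differentiable_on k S f"
    by (cases k) (simp_all add: c D d times_differentiable_on_const)
qed

lemma has_derivative_vec:
  fixes f :: "'a::real_normed_vector \<Rightarrow> 'n::finite \<Rightarrow> 'b::euclidean_space"
  assumes "\<And>i. ((\<lambda>x. f x i) has_derivative (\<lambda>v. f' v i)) (at x)"
  shows "((\<lambda>x. \<chi> i. f x i) has_derivative (\<lambda>v. \<chi> i. f' v i)) (at x)"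
  unfolding has_derivative_componentwise_within[of "\<lambda>x. \<chi> i. f x i"]
proof
  fix b :: "'b^'n"
  assume "b \<in> Basis"
  then obtain i u where "b = axis i u"
    by (auto simp: Basis_vec_def)
  then show "((\<lambda>x. (\<chi> i. f x i) \<bullet> b) has_derivative (\<lambda>v. (\<chi> i. f' v i) \<bullet> b)) (at x)"
    using has_derivative_inner_left[OF assms, of i u] by (simp add: inner_axis)
qed

section \<open>Operators that are diagonal on coordinate bivectors\<close>

definition diag_mat :: "('n::finite \<Rightarrow> real) \<Rightarrow> real^'n^'n" where
  "diag_mat d = (\<chi> i j. if i = j then d i else 0)"

lemma diag_mat_nth [simp]: "diag_mat d $ i $ j = (if i = j then d i else 0)"
  by (simp add: diag_mat_def)

lemma diag_mat_mult_left: "(diag_mat a ** B) $ i $ j = a i * B $ i $ j"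
proof -
  have "diag_mat a $ i $ k * B $ k $ j = (if k = i then a i * B $ i $ j else 0)" for k
    by simp
  then show ?thesis
    by (simp add: matrix_matrix_mult_def del: diag_mat_nth)
qed

lemma diag_mat_mult_right: "(B ** diag_mat a) $ i $ j = B $ i $ j * a j"
proof -
  have "B $ i $ k * diag_mat a $ k $ j = (if k = j then B $ i $ j * a j else 0)" for k
    by simp
  then show ?thesis
    by (simp add: matrix_matrix_mult_def del: diag_mat_nth)
qed

lemma diag_mat_mult: "diag_mat a ** diag_mat b = diag_mat (\<lambda>i. a i * b i)"
  by (simp add: vec_eq_iff diag_mat_mult_left)

lemma transpose_diag_mat [simp]: "transpose (diag_mat d) = diag_mat d"
  by (auto simp: transpose_def vec_eq_iff)

lemma mat_1_eq_diag_mat: "mat 1 = diag_mat (\<lambda>_. 1)"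
  by (simp add: mat_def vec_eq_iff)

lemma matrix_inv_diag_mat:
  assumes "\<And>i. d i \<noteq> 0"
  shows "matrix_inv (diag_mat d) = diag_mat (\<lambda>i. 1 / d i)"
  unfolding matrix_inv_def
proof (rule some_equality)
  have inv: "diag_mat d ** diag_mat (\<lambda>i. 1 / d i) = mat 1" "diag_mat (\<lambda>i. 1 / d i) ** diag_mat d = mat 1"
    using assms by (simp_all add: diag_mat_mult mat_1_eq_diag_mat)
  then show "diag_mat d ** diag_mat (\<lambda>i. 1 / d i) = mat 1 \<and> diag_mat (\<lambda>i. 1 / d i) ** diag_mat d = mat 1"
    by simp
  fix B assume B: "diag_mat d ** B = mat 1 \<and> B ** diag_mat d = mat 1"
  have "B = B ** (diag_mat d ** diag_mat (\<lambda>i. 1 / d i))"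
    by (simp only: inv matrix_mul_rid)
  also have "\<dots> = diag_mat (\<lambda>i. 1 / d i)"
    by (simp only: matrix_mul_assoc B matrix_mul_lid)
  finally show "B = diag_mat (\<lambda>i. 1 / d i)" .
qed

text \<open>
  Nested conditionals instead of a conjunction: in this form each of the two sums collapses by
  the rewrite rule for a sum of delta functions.
\<close>

lemma sum_if_eq_pair:
  "(\<Sum>k\<in>UNIV. \<Sum>l\<in>UNIV. if k = i then if l = j then c else 0 else 0) = c"
  for i :: "'n::finite" and j :: "'m::finite" and c :: real
proof -
  have "(\<Sum>l\<in>UNIV. if k = i then if l = j then c else 0 else 0) = (if k = i then c else 0)" for k
    by simp
  then show ?thesis by simp
qed

lemma sum_diag_mat:
  "(\<Sum>k\<in>UNIV. \<Sum>l\<in>UNIV. diag_mat a $ i $ k * (diag_mat b $ j $ l * f k l)) = a i * (b j * f i j)"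
  "(\<Sum>k\<in>UNIV. \<Sum>l\<in>UNIV. diag_mat a $ i $ k * diag_mat b $ j $ l * f k l) = a i * b j * f i j"
proof -
  have "diag_mat a $ i $ k * (diag_mat b $ j $ l * f k l)
      = (if k = i then if l = j then a i * (b j * f i j) else 0 else 0)" for k l
    by simp
  then show "(\<Sum>k\<in>UNIV. \<Sum>l\<in>UNIV. diag_mat a $ i $ k * (diag_mat b $ j $ l * f k l)) = a i * (b j * f i j)"
    by (simp add: sum_if_eq_pair del: diag_mat_nth)
  then show "(\<Sum>k\<in>UNIV. \<Sum>l\<in>UNIV. diag_mat a $ i $ k * diag_mat b $ j $ l * f k l) = a i * b j * f i j"
    by (simp add: mult.assoc)
qed

text \<open>
  For a diagonal metric the coordinate bivectors are orthogonal, and the factors \<open>d i * d j\<close> of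
  their square norms cancel against the inverse metric in the Hilbert--Schmidt norm. Only the
  eigenvalues remain, so no orthonormal frame has to be introduced.
\<close>

lemma op_norm_diagonal:
  fixes t :: "'n::finite \<Rightarrow> 'n \<Rightarrow> real"
  assumes d: "\<And>i. d i > 0"
    and T: "\<And>i j. T (wedge (axis i 1) (axis j 1)) = t i j *\<^sub>R wedge (axis i 1) (axis j 1)"
  shows "op_norm (diag_mat d) T = sqrt ((1/2) * (\<Sum>i\<in>UNIV. \<Sum>j\<in>UNIV. if i = j then 0 else (t i j)\<^sup>2))"
proof -
  have inner: "bivector_inner (diag_mat d) \<omega> \<eta>
      = (1/2) * (\<Sum>i\<in>UNIV. \<Sum>j\<in>UNIV. d i * d j * \<omega> $ i $ j * \<eta> $ i $ j)" for \<omega> \<eta> :: "real^'n^'n"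
    by (simp add: bivector_inner_def mult.assoc sum_diag_mat del: diag_mat_nth)
  have norm_wedge: "bivector_inner (diag_mat d) (c *\<^sub>R wedge (axis i 1) (axis j 1)) (c *\<^sub>R wedge (axis i 1) (axis j 1))
      = (if i = j then 0 else d i * d j * c\<^sup>2)" for c i j
  proof (cases "i = j")
    case True
    then show ?thesis by (simp add: inner wedge_def)
  next
    case False
    \<comment> \<open>The bivector has exactly the two entries \<open>(i, j)\<close> and \<open>(j, i)\<close>, of equal square.\<close>
    have "d a * d b * (c *\<^sub>R wedge (axis i 1) (axis j 1)) $ a $ b * (c *\<^sub>R wedge (axis i 1) (axis j 1)) $ a $ b
        = (if a = i then if b = j then d i * d j * c\<^sup>2 else 0 else 0)
          + (if a = j then if b = i then d i * d j * c\<^sup>2 else 0 else 0)" for a b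
      using False by (auto simp: wedge_def axis_def power2_eq_square)
    then show ?thesis
      using False by (simp add: inner sum.distrib sum_if_eq_pair)
  qed
  have "matrix_inv (diag_mat d) = diag_mat (\<lambda>i. 1 / d i)"
    using d by (intro matrix_inv_diag_mat) (metis less_irrefl)
  then have "op_norm (diag_mat d) T = sqrt ((1/2) * (\<Sum>i\<in>UNIV. \<Sum>j\<in>UNIV. 1 / d i * (1 / d j) *
       bivector_inner (diag_mat d) (T (wedge (axis i 1) (axis j 1))) (T (wedge (axis i 1) (axis j 1)))))"
    by (simp add: op_norm_def sum_diag_mat del: diag_mat_nth)
  also have "(\<Sum>i\<in>UNIV. \<Sum>j\<in>UNIV. 1 / d i * (1 / d j) *
       bivector_inner (diag_mat d) (T (wedge (axis i 1) (axis j 1))) (T (wedge (axis i 1) (axis j 1))))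
     = (\<Sum>i\<in>UNIV. \<Sum>j\<in>UNIV. if i = j then 0 else (t i j)\<^sup>2)"
    using d by (intro sum.cong refl) (simp add: T norm_wedge less_imp_neq[THEN not_sym])
  finally show ?thesis .
qed

lemma Rm_Ric0_diagonal:
  fixes G :: "real^'n::finite \<Rightarrow> real^'n^'n"
  assumes "ricci0 G x = diag_mat r"
  shows "Rm_Ric0 G x (wedge (axis i 1) (axis j 1))
     = ((r i + r j) / (real CARD('n) - 2)) *\<^sub>R wedge (axis i 1) (axis j 1)"
proof -
  have "(r a + r b) * wedge (axis i 1) (axis j 1) $ a $ b = (r i + r j) * wedge (axis i 1) (axis j 1) $ a $ b"
    for a b :: 'n
    by (auto simp: wedge_def axis_def)
  then have "diag_mat r ** wedge (axis i 1) (axis j 1) + wedge (axis i 1) (axis j 1) ** diag_mat r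
      = (r i + r j) *\<^sub>R wedge (axis i 1) (axis j 1)"
    by (simp add: vec_eq_iff diag_mat_mult_left diag_mat_mult_right algebra_simps)
  then show ?thesis
    by (simp add: Rm_Ric0_def assms)
qed

section \<open>A product of half-planes\<close>

text \<open>
  The index type is arbitrary, so the splitting of the coordinates into planes is recorded by an
  involution: \<open>i\<close> and \<open>partner i\<close> span one hyperbolic plane, in which the element of \<open>fibre\<close> is
  the coordinate \<open>y\<close> and the other one is \<open>t\<close>. A fixed point of the involution is a line factor.
\<close>

locale half_plane_product =
  fixes partner :: "'n::finite \<Rightarrow> 'n" and fibre :: "'n set"
  assumes partner_partner [simp]: "partner (partner i) = i"
    and partner_notin_fibre [simp]: "i \<in> fibre \<Longrightarrow> partner i \<notin> fibre"
    and partner_in_fibre: "i \<notin> fibre \<Longrightarrow> partner i \<noteq> i \<Longrightarrow> partner i \<in> fibre"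
    and unique_fixed: "partner i = i \<Longrightarrow> partner j = j \<Longrightarrow> i = j"
begin

text \<open>The logarithm of the length of the coordinate vector \<open>\<partial>_i\<close>: it is the coordinate \<open>t\<close> for \<open>y\<close>
  directions.\<close>

definition log_scale :: "'n \<Rightarrow> real^'n \<Rightarrow> real" where
  "log_scale i x = (if i \<in> fibre then x $ partner i else 0)"

definition metric :: "real^'n \<Rightarrow> real^'n^'n" where
  "metric x = diag_mat (\<lambda>i. exp (2 * log_scale i x))"

lemma log_scale_linear: "bounded_linear (log_scale i)"
  unfolding log_scale_def by (cases "i \<in> fibre") (auto simp: bounded_linear_vec_nth bounded_linear_zero)

lemma log_scale_base [simp]: "i \<notin> fibre \<Longrightarrow> log_scale i x = 0"
  by (simp add: log_scale_def)

lemma partner_inject [simp]: "partner i = partner j \<longleftrightarrow> i = j"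
  by (metis partner_partner)

lemma partner_ne [simp]: "i \<in> fibre \<Longrightarrow> partner i \<noteq> i" "i \<in> fibre \<Longrightarrow> i \<noteq> partner i"
  by (metis partner_notin_fibre)+

section \<open>Homogeneity\<close>

text \<open>
  The left translation taking \<open>p\<close> to \<open>q\<close> in the product of affine groups: it shifts the coordinates
  \<open>t\<close> and compensates the resulting change of the length of \<open>\<partial>_y\<close> by rescaling \<open>y\<close>.
\<close>

definition translation :: "real^'n \<Rightarrow> real^'n \<Rightarrow> real^'n \<Rightarrow> real^'n" where
  "translation p q x = (\<chi> i. exp (- log_scale i (q - p)) * (x $ i - p $ i) + q $ i)"

lemma translation_maps: "translation p q p = q"
  by (simp add: translation_def vec_eq_iff)

lemma log_scale_diff: "log_scale i (q - p) = - log_scale i (p - q)"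
  by (simp add: log_scale_def)

text \<open>
  The scale factor depends on \<open>q - p\<close> only through coordinates \<open>t\<close>, and these are merely shifted;
  hence swapping \<open>p\<close> and \<open>q\<close> inverts the map.
\<close>

lemma translation_inverse: "translation q p (translation p q x) = x"
  by (simp add: translation_def vec_eq_iff log_scale_diff[of _ q p] mult_exp_exp flip: mult.assoc)

lemma bij_translation: "bij (translation p q)"
  by (rule bijI'[where f="translation p q"]) (metis translation_inverse)+

lemma inv_translation: "inv_into UNIV (translation p q) = translation q p"
  by (rule inv_equality) (auto simp: translation_inverse)

lemma log_scale_translation: "log_scale i (translation p q x) = log_scale i x + log_scale i (q - p)"
  by (simp add: log_scale_def translation_def)

lemma translation_has_derivative:
  "(translation p q has_derivative (\<lambda>v. \<chi> i. exp (- log_scale i (q - p)) * v $ i)) (at x)"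
  unfolding translation_def
  by (rule has_derivative_vec)
    (auto intro!: derivative_eq_intros bounded_linear_imp_has_derivative bounded_linear_vec_nth)

text \<open>
  Smoothness by induction needs a class of maps closed under directional derivatives. Since
  \<open>log_scale i\<close> is linear, differentiating along \<open>v\<close> only changes the constant weights, from \<open>c i\<close>
  to \<open>c i * (2 * log_scale i v)\<close>.
\<close>

lemma times_differentiable_weighted_metric:
  "times_differentiable_on k S (\<lambda>x. diag_mat (\<lambda>i. c i * exp (2 * log_scale i x)))"
proof (induction k arbitrary: c)
  case 0
  then show ?case
    apply (simp add: diag_mat_def)
    apply (intro continuous_on_vec_lambda)
    subgoal for i j
      by (cases "i = j") 
        (auto intro!: continuous_on_mult continuous_on_const continuous_on_exp continuous_on_id
           bounded_linear.continuous_on[OF log_scale_linear])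
    done
next
  case (Suc k)
  let ?f = "\<lambda>c x. diag_mat (\<lambda>i. c i * exp (2 * log_scale i x))"
  have d: "(?f c has_derivative (\<lambda>v. ?f (\<lambda>i. c i * (2 * log_scale i v)) x)) (at x)" for x
    unfolding diag_mat_def
    apply (intro has_derivative_vec)
    subgoal for i j
      by (cases "i = j")
        (auto intro!: derivative_eq_intros bounded_linear_imp_has_derivative log_scale_linear)
    done
  have "frechet_derivative (?f c) (at x) = (\<lambda>v. ?f (\<lambda>i. c i * (2 * log_scale i v)) x)" for x
    using frechet_derivative_at[OF d[of x]] by simp
  moreover have "?f c differentiable at x" for x
    by (rule differentiableI[OF d])
  ultimately show ?case
    using Suc[of "\<lambda>i. c i * (2 * log_scale i v)" for v] by simp
qed

lemma smooth_metric: "smooth_on S metric"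
  using times_differentiable_weighted_metric[of _ S "\<lambda>_. 1"]
  unfolding smooth_on_def metric_def[abs_def] by simp

definition half_plane_manifold :: "(real^'n, 'n) manifold_data" where
  "half_plane_manifold = \<lparr>space_of = euclidean, atlas = {(UNIV, id)}, metric_in = (\<lambda>_. metric)\<rparr>"

lemma half_plane_manifold_simps [simp]:
  "space_of half_plane_manifold = euclidean" "atlas half_plane_manifold = {(UNIV, id)}" "metric_in half_plane_manifold c = metric"
  by (simp_all add: half_plane_manifold_def)

lemma local_rep_global [simp]: "local_rep F (UNIV, id) (UNIV, id) = F"
  by (rule ext) (simp add: local_rep_def param_def)

lemma local_dom_global [simp]: "local_dom F (UNIV, id) (UNIV, id) = UNIV"
  by (simp add: local_dom_def)

lemma smooth_manifold_half_planes: "smooth_manifold half_plane_manifold"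
proof -
  have "second_countable (euclidean :: (real^'n) topology)"
  proof -
    obtain \<B> :: "(real^'n) set set" where \<B>: "countable \<B>" "\<And>C. C \<in> \<B> \<Longrightarrow> open C"
       "\<And>S. open S \<Longrightarrow> \<exists>U. U \<subseteq> \<B> \<and> S = \<Union>U"
      using univ_second_countable by blast
    show ?thesis
      unfolding second_countable_def open_openin[symmetric]
    proof (intro exI[of _ \<B>] conjI ballI allI impI)
      fix U and x :: "real^'n"
      assume "open U \<and> x \<in> U"
      then obtain \<U> where "\<U> \<subseteq> \<B>" "U = \<Union>\<U>" "x \<in> U"
        using \<B>(3) by blast
      then show "\<exists>V\<in>\<B>. x \<in> V \<and> V \<subseteq> U"
        by blast
    qed (fact \<B>)+
  qed
  moreover have "smooth_on UNIV (id :: real^'n \<Rightarrow> real^'n)"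
    by (rule smooth_on_if_constant_derivative) (rule has_derivative_id)
  ultimately show ?thesis
    by (simp add: smooth_manifold_def chart_on_def)
qed

lemma preserves_metric_translation: "preserves_metric half_plane_manifold (translation p q)"
proof -
  have "matrix (frechet_derivative (translation p q) (at x)) = diag_mat (\<lambda>i. exp (- log_scale i (q - p)))" for x
    unfolding frechet_derivative_at[OF translation_has_derivative[of p q x], symmetric]
    by (simp add: matrix_def vec_eq_iff axis_def)
  then show ?thesis
    by (simp add: preserves_metric_def pullback_form_def metric_def diag_mat_mult log_scale_translation
        Let_def mult_exp_exp)
qed

lemma translation_self: "translation p p = id"
  by (simp add: translation_def fun_eq_iff vec_eq_iff log_scale_def)

lemma riemannian_manifold_half_planes: "riemannian_manifold half_plane_manifold"
proof -
  have "v \<bullet> (metric x *v v) > 0" if v: "v \<noteq> 0" for x v :: "real^'n"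
  proof -
    have "(metric x *v v) $ i = exp (2 * log_scale i x) * v $ i" for i
    proof -
      have "metric x $ i $ j * v $ j = (if j = i then exp (2 * log_scale i x) * v $ i else 0)" for j
        by (simp add: metric_def)
      then show ?thesis by (simp add: matrix_vector_mult_def)
    qed
    then have "v \<bullet> (metric x *v v) = (\<Sum>i\<in>UNIV. exp (2 * log_scale i x) * (v $ i)\<^sup>2)"
      by (simp add: inner_vec_def power2_eq_square algebra_simps)
    moreover obtain i where "v $ i \<noteq> 0"
      using v by (metis vec_eq_iff zero_index)
    ultimately show ?thesis
      by (simp add: sum_pos2[of UNIV i])
  qed
  moreover have "preserves_metric half_plane_manifold id"
    using preserves_metric_translation[of 0 0] by (simp add: translation_self)
  ultimately show ?thesis
    by (simp add: riemannian_manifold_def smooth_manifold_half_planes smooth_metric) (simp add: metric_def)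
qed

lemma smooth_map_translation: "smooth_map half_plane_manifold (translation p q)"
proof -
  have "continuous_on UNIV (translation p q)"
    using has_derivative_continuous[OF translation_has_derivative]
    by (simp add: continuous_at_imp_continuous_on)
  moreover have "smooth_on UNIV (translation p q)"
    using translation_has_derivative by (rule smooth_on_if_constant_derivative)
  ultimately show ?thesis
    by (simp add: smooth_map_def)
qed

lemma homogeneous_half_planes: "homogeneous half_plane_manifold"
proof -
  have "connected_space (euclidean :: (real^'n) topology)"
    by (metis connectedin_topspace connectedin_iff_connected connected_UNIV topspace_euclidean)
  moreover have "translation p q \<in> isometries half_plane_manifold" for p q
    by (simp add: isometries_def bij_translation inv_translation smooth_map_translation
        preserves_metric_translation)
  ultimately show ?thesis
    unfolding homogeneous_def half_plane_manifold_simps using translation_maps by blast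
qed

section \<open>Curvature of a product of half-planes\<close>

text \<open>The additive constant and the weight are there to cover entries of the metric and Christoffel
  symbols at once, including those that vanish identically.\<close>

lemma coord_deriv_exp:
  "coord_deriv k (\<lambda>y. b + c * exp (2 * log_scale i y)) x
     = (if i \<in> fibre \<and> k = partner i then 2 * c * exp (2 * log_scale i x) else 0)"
proof -
  have d: "((\<lambda>y. b + c * exp (2 * log_scale i y)) has_derivative
        (\<lambda>v. c * (exp (2 * log_scale i x) * (2 * log_scale i v)))) (at x)"
    by (auto intro!: derivative_eq_intros bounded_linear_imp_has_derivative log_scale_linear)
  show ?thesis
    unfolding coord_deriv_def frechet_derivative_at[OF d, symmetric]
    by (auto simp: log_scale_def axis_def)
qed

lemma coord_deriv_metric:
  "coord_deriv k (\<lambda>y. metric y $ i $ j) x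
     = (if i = j \<and> i \<in> fibre \<and> k = partner i then 2 * exp (2 * log_scale i x) else 0)"
  using coord_deriv_exp[of k 0 1 i x] coord_deriv_exp[of k 0 0 i x]
  by (cases "i = j") (simp_all add: metric_def)

lemma matrix_inv_metric:
  "matrix_inv (metric x) = diag_mat (\<lambda>i. 1 / exp (2 * log_scale i x))"
  by (simp add: metric_def matrix_inv_diag_mat)

text \<open>
  In a plane with coordinates \<open>t\<close>, \<open>y\<close> the nonzero symbols are \<open>\<Gamma>^y_ty = \<Gamma>^y_yt = 1\<close> and
  \<open>\<Gamma>^t_yy = - exp (2 t)\<close>; the three summands below are these three cases.
\<close>

lemma christoffel_metric:
  "christoffel metric k i j x =
     (if k = j \<and> j \<in> fibre \<and> i = partner j then 1 else 0)
     + (if k = i \<and> i \<in> fibre \<and> j = partner i then 1 else 0)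
     - (if i = j \<and> i \<in> fibre \<and> k = partner i then exp (2 * log_scale i x) else 0)"
proof -
  have "christoffel metric k i j x = 1/2 * (1 / exp (2 * log_scale k x) *
       (coord_deriv i (\<lambda>y. metric y $ j $ k) x + coord_deriv j (\<lambda>y. metric y $ i $ k) x
        - coord_deriv k (\<lambda>y. metric y $ i $ j) x))"
    unfolding christoffel_def matrix_inv_metric
    by (simp add: if_distrib[of "\<lambda>u. u * _"] cong: if_cong)
  moreover have
    "1/2 * (1 / exp (2 * log_scale k x) * coord_deriv i (\<lambda>y. metric y $ j $ k) x)
      = (if k = j \<and> j \<in> fibre \<and> i = partner j then 1 else 0)"
    "1/2 * (1 / exp (2 * log_scale k x) * coord_deriv j (\<lambda>y. metric y $ i $ k) x)
      = (if k = i \<and> i \<in> fibre \<and> j = partner i then 1 else 0)"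
    by (auto simp: coord_deriv_metric)
  moreover have
    "1/2 * (1 / exp (2 * log_scale k x) * coord_deriv k (\<lambda>y. metric y $ i $ j) x)
      = (if i = j \<and> i \<in> fibre \<and> k = partner i then exp (2 * log_scale i x) else 0)"
    \<comment> \<open>Here \<open>k\<close> is a \<open>t\<close> direction, so the inverse metric contributes the factor \<open>1\<close>.\<close>
    by (auto simp: coord_deriv_metric log_scale_def)
  ultimately show ?thesis
    by (simp add: ring_distribs)
qed

lemma coord_deriv_christoffel:
  "coord_deriv m (christoffel metric k i j) x =
     (if i = j \<and> i \<in> fibre \<and> k = partner i \<and> m = partner i then - 2 * exp (2 * log_scale i x) else 0)"
proof -
  have "christoffel metric k i j = (\<lambda>y.
     ((if k = j \<and> j \<in> fibre \<and> i = partner j then 1 else 0)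
     + (if k = i \<and> i \<in> fibre \<and> j = partner i then 1 else 0))
     + (if i = j \<and> i \<in> fibre \<and> k = partner i then - 1 else 0) * exp (2 * log_scale i y))"
    by (rule ext) (auto simp: christoffel_metric)
  then show ?thesis
    by (simp only: coord_deriv_exp) simp
qed

text \<open>
  For fixed lower indices each summand of the Christoffel symbol is concentrated at one upper index.
  The quadratic terms of the Riemann tensor become closed expressions in this way.
\<close>

lemma sum_christoffel:
  "(\<Sum>m\<in>UNIV. christoffel metric m j k x * f m) =
     (if k \<in> fibre \<and> j = partner k then f k else 0)
     + (if j \<in> fibre \<and> k = partner j then f j else 0)
     - (if j = k \<and> j \<in> fibre then exp (2 * log_scale j x) * f (partner j) else 0)"
proof -
  have "christoffel metric m j k x * f m =
     (if m = k then if k \<in> fibre \<and> j = partner k then f k else 0 else 0)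
     + (if m = j then if j \<in> fibre \<and> k = partner j then f j else 0 else 0)
     - (if m = partner j then if j = k \<and> j \<in> fibre then exp (2 * log_scale j x) * f (partner j) else 0 else 0)" for m
    unfolding christoffel_metric left_diff_distrib distrib_right
    by (intro arg_cong2[where f = "(-)"] arg_cong2[where f = "(+)"]) auto
  then show ?thesis
    by (simp add: sum.distrib sum_subtractf)
qed

text \<open>
  This says that \<open>R(X,Y)Z = - (\<langle>Y,Z\<rangle> X - \<langle>X,Z\<rangle> Y)\<close> for \<open>X\<close>, \<open>Y\<close> tangent to one plane, i.e. that
  each plane has curvature \<open>-1\<close>, and that \<open>R(X,Y)\<close> vanishes for \<open>X\<close>, \<open>Y\<close> tangent to different
  factors. After the two quadratic sums have been evaluated, what is left is a comparison of delta
  functions, settled by deciding which of the four indices coincide.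
\<close>

lemma riemann_metric:
  "riemann metric i j k l x =
     (if j = partner i \<and> i \<noteq> j
      then (if l = j \<and> k = i then exp (2 * log_scale i x) else 0)
         - (if l = i \<and> k = j then exp (2 * log_scale j x) else 0)
      else 0)"
proof -
  have "riemann metric i j k l x =
     coord_deriv i (christoffel metric l j k) x - coord_deriv j (christoffel metric l i k) x
     + ((\<Sum>m\<in>UNIV. christoffel metric m j k x * christoffel metric l i m x)
        - (\<Sum>m\<in>UNIV. christoffel metric m i k x * christoffel metric l j m x))"
    by (simp add: riemann_def sum_subtractf)
  also have "\<dots> =
     (if j = partner i \<and> i \<noteq> j
      then (if l = j \<and> k = i then exp (2 * log_scale i x) else 0)
         - (if l = i \<and> k = j then exp (2 * log_scale j x) else 0)
      else 0)"
  proof (cases "i = j")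
    case True
    then show ?thesis by simp
  next
    case i_ne_j: False
    show ?thesis
    proof (cases "j = partner i")
      case j: True
      then consider "i \<in> fibre" | "i \<notin> fibre" "partner i \<in> fibre"
        using i_ne_j partner_in_fibre by metis
      then show ?thesis
      proof cases
        case 1
        show ?thesis
          apply (cases "k = i"; cases "k = j"; cases "l = i"; cases "l = j")
          using 1 j i_ne_j unfolding sum_christoffel
          apply (simp_all add: christoffel_metric coord_deriv_christoffel)
          apply auto
          done
      next
        case 2
        show ?thesis
          apply (cases "k = i"; cases "k = j"; cases "l = i"; cases "l = j")
          using 2 j i_ne_j unfolding sum_christoffel
          apply (simp_all add: christoffel_metric coord_deriv_christoffel)
          apply auto
          done
      qed
    next
      case False
      then show ?thesis
        using i_ne_j unfolding sum_christoffel
        apply (cases "i \<in> fibre"; cases "j \<in> fibre"; cases "k = i"; cases "k = j";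
            cases "k = partner i"; cases "k = partner j")
        apply (simp_all add: christoffel_metric coord_deriv_christoffel)
        apply auto
        done
    qed
  qed
  finally show ?thesis .
qed

abbreviation paired :: "'n set" where
  "paired \<equiv> {i. partner i \<noteq> i}"

lemma not_flat_half_planes:
  assumes "i \<in> paired"
  shows "\<not> flat half_plane_manifold"
proof -
  have "riemann metric i (partner i) i (partner i) 0 \<noteq> 0"
    using assms by (simp add: riemann_metric)
  then show ?thesis
    unfolding flat_def by (simp del: split_paired_Ex) blast
qed

lemma ricci_metric: "ricci metric x = diag_mat (\<lambda>i. if i \<in> paired then - 1 else 0)"
proof -
  have "riemann metric i j k i x
      = (if i = partner j then if j = k \<and> j \<in> paired then - exp (2 * log_scale j x) else 0 else 0)" for i j k
    by (auto simp: riemann_metric)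
  then have "(\<chi> j k. \<Sum>i\<in>UNIV. riemann metric i j k i x)
      = diag_mat (\<lambda>j. if j \<in> paired then - exp (2 * log_scale j x) else 0)"
    by (simp add: vec_eq_iff)
  then have "ricci metric x = diag_mat (\<lambda>j. 1 / exp (2 * log_scale j x)
      * (if j \<in> paired then - exp (2 * log_scale j x) else 0))"
    unfolding ricci_def matrix_inv_metric by (simp only: diag_mat_mult)
  also have "(\<lambda>j. 1 / exp (2 * log_scale j x) * (if j \<in> paired then - exp (2 * log_scale j x) else 0))
      = (\<lambda>j. if j \<in> paired then - 1 else 0)"
    by auto
  finally show ?thesis .
qed

lemma scal_metric: "scal metric x = - real (card paired)"
  unfolding scal_def ricci_metric trace_def by (simp add: sum.If_cases sum_negf)

text \<open>
  The entries are computed for an arbitrary argument first, because there the two delta functions of the Riemann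
  tensor can be summed out without knowing which entries of the argument vanish. The case \<open>i = j\<close>
  is included: both sides are then \<open>0\<close>.
\<close>

lemma Rm_metric:
  "Rm metric x (wedge (axis i 1) (axis j 1))
     = (if j = partner i then - 1 else 0) *\<^sub>R wedge (axis i 1) (axis j 1)"
proof -
  have anti: "wedge (axis i 1) (axis j 1) $ b $ a = - wedge (axis i 1) (axis j 1) $ a $ b" for a b :: 'n
    by (simp add: wedge_def)
  have Rm_entry: "Rm metric x \<omega> $ a $ b = (if b = partner a \<and> a \<noteq> b then (1/2) * (\<omega> $ b $ a - \<omega> $ a $ b) else 0)"
    for \<omega> :: "real^'n^'n" and a b
  proof -
    have "(\<Sum>k\<in>UNIV. \<omega> $ i $ j * matrix_inv (metric x) $ b $ k * riemann metric i j k a x)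
        = \<omega> $ i $ j / exp (2 * log_scale b x) * riemann metric i j b a x" for i j
    proof -
      have "\<omega> $ i $ j * matrix_inv (metric x) $ b $ k * riemann metric i j k a x
        = (if k = b then \<omega> $ i $ j / exp (2 * log_scale b x) * riemann metric i j b a x else 0)" for k
        by (simp add: matrix_inv_metric)
      then show ?thesis by simp
    qed
    moreover have "\<omega> $ i $ j / exp (2 * log_scale b x) * riemann metric i j b a x
        = (if i = b then if j = a then if b = partner a \<and> a \<noteq> b then \<omega> $ b $ a else 0 else 0 else 0)
        - (if i = a then if j = b then if b = partner a \<and> a \<noteq> b then \<omega> $ a $ b else 0 else 0 else 0)" for i j
    proof (cases "b = partner a \<and> a \<noteq> b")
      case True
      then have b: "b = partner a" and a: "a \<noteq> partner a" "partner a \<noteq> a"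
        by auto
      consider "i = a \<and> j = partner a" | "i = partner a \<and> j = a"
        | "\<not> (i = a \<and> j = partner a)" "\<not> (i = partner a \<and> j = a)"
        by blast
      then show ?thesis
      proof cases
        case 1
        with a show ?thesis by (simp add: b riemann_metric)
      next
        case 2
        with a show ?thesis by (simp add: b riemann_metric)
      next
        case 3
        then have "\<not> (a = j \<and> partner a = i)" "\<not> (a = i \<and> partner a = j)"
          by blast+
        then have "riemann metric i j b a x = 0"
          unfolding b riemann_metric by (simp only: if_False diff_self if_cancel)
        with 3 show ?thesis unfolding b by (simp split: if_split)
      qed
    next
      case False
      have "riemann metric i j b a x = 0"
      proof (cases "j = partner i \<and> i \<noteq> j")
        case True
        then have "\<not> (a = j \<and> b = i)" "\<not> (a = i \<and> b = j)"
          using False by force+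
        then show ?thesis
          by (simp only: riemann_metric if_False diff_self if_cancel)
      next
        case False
        then show ?thesis
          by (simp only: riemann_metric if_False)
      qed
      with False show ?thesis by simp
    qed
    ultimately have "Rm metric x \<omega> $ a $ b = (1/2) *
        ((if b = partner a \<and> a \<noteq> b then \<omega> $ b $ a else 0) - (if b = partner a \<and> a \<noteq> b then \<omega> $ a $ b else 0))"
      by (simp only: Rm_def vec_lambda_beta sum_subtractf sum_if_eq_pair)
    also have "(1/2) * ((if P then u else 0) - (if P then v else 0)) = (if P then (1/2) * (u - v) else 0)"
      for P and u v :: real
      by simp
    finally show ?thesis .
  qed
  have half: "(1/2) * (- w - w) = - w" for w :: real
    by simp
  have "Rm metric x (wedge (axis i 1) (axis j 1)) $ a $ b
      = (if b = partner a \<and> a \<noteq> b then - wedge (axis i 1) (axis j 1) $ a $ b else 0)" for a b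
    by (simp only: Rm_entry anti[of b a] half)
  moreover have "(if b = partner a \<and> a \<noteq> b then - wedge (axis i 1) (axis j 1) $ a $ b else 0)
      = (if j = partner i then - 1 else 0) * wedge (axis i 1) (axis j 1) $ a $ b" for a b :: 'n
  proof -
    have "wedge (axis i 1) (axis j 1) $ a $ b = (0::real) \<or> (a = i \<and> b = j) \<or> (a = j \<and> b = i)"
      by (auto simp: wedge_def axis_def)
    moreover have "i = partner j \<longleftrightarrow> j = partner i"
      by (metis partner_partner)
    ultimately show ?thesis
      by (auto simp: wedge_def)
  qed
  ultimately show ?thesis
    by (simp add: vec_eq_iff)
qed

lemma ricci0_metric:
  "ricci0 metric x =
     diag_mat (\<lambda>i. (if i \<in> paired then - 1 else 0) + real (card paired) / real CARD('n))"
  unfolding ricci0_def ricci_metric scal_metric by (simp add: mat_1_eq_diag_mat vec_eq_iff)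

section \<open>The norms of the Weyl part and of the curvature operator\<close>

lemma card_paired: "real CARD('n) = real (card paired) \<or> real CARD('n) = real (card paired) + 1"
proof -
  have "card (- paired) \<le> 1"
    using unique_fixed by (subst One_nat_def, subst card_le_Suc0_iff_eq) auto
  moreover have "CARD('n) = card paired + card (- paired)"
    using card_Un_disjoint[of paired "- paired"] by simp
  ultimately have "CARD('n) = card paired \<or> CARD('n) = card paired + 1"
    by linarith
  then show ?thesis by auto
qed

lemma paired_if_card_eq: "real CARD('n) = real (card paired) \<Longrightarrow> i \<in> paired"
proof -
  assume "real CARD('n) = real (card paired)"
  then have "paired = UNIV"
    by (intro card_subset_eq) auto
  then show ?thesis by blast
qed

text \<open>
  With \<open>m = card paired\<close>, subtracting the trace parts shifts the eigenvalues by \<open>1/(m - 1)\<close> on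
  bivectors without a line direction and leaves \<open>0\<close> on the others. It is convenient that this form is
  the same for \<open>m = n\<close> and \<open>m = n - 1\<close>: the Weyl part of the product with a line is the
  Weyl part of the product of planes, extended by zero.
\<close>

lemma Weyl_metric:
  assumes n: "CARD('n) \<ge> 4" and ij: "i \<noteq> j"
  shows "Weyl metric x (wedge (axis i 1) (axis j 1)) =
    (if i \<in> paired \<and> j \<in> paired
     then (if j = partner i then - 1 else 0) + 1 / (real (card paired) - 1) else 0)
      *\<^sub>R wedge (axis i 1) (axis j 1)"
proof -
  define m where "m = real (card paired)"
  define N where "N = real CARD('n)"
  \<comment> \<open>\<open>r\<close> are the eigenvalues of \<open>Ric_0\<close>, \<open>\<kappa>\<close> is the sectional curvature.\<close>
  define r where "r i = (if i \<in> paired then - 1 else 0) + m / N" for i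
  define \<kappa> where "\<kappa> = (if j = partner i then - 1 else 0 :: real)"
  have N: "N \<ge> 4" using n by (simp add: N_def)
  have m: "N = m \<or> N = m + 1"
    using card_paired by (simp add: m_def N_def)
  have fixed: "N = m + 1" if "k \<notin> paired" for k
    using m paired_if_card_eq[of k] that by (auto simp: m_def N_def)
  have "Weyl metric x (wedge (axis i 1) (axis j 1))
    = (\<kappa> + m / (N * (N - 1)) - (r i + r j) / (N - 2)) *\<^sub>R wedge (axis i 1) (axis j 1)"
    unfolding Weyl_def Rm_I_def Rm_metric scal_metric Rm_Ric0_diagonal[OF ricci0_metric]
    by (simp add: \<kappa>_def r_def m_def N_def algebra_simps)
  also have "\<kappa> + m / (N * (N - 1)) - (r i + r j) / (N - 2)
     = (if i \<in> paired \<and> j \<in> paired then \<kappa> + 1 / (m - 1) else 0)"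
  proof (cases "i \<in> paired \<and> j \<in> paired")
    case True
    then have "r i + r j = 2 * m / N - 2"
      by (simp add: r_def)
    moreover have "m / (N * (N - 1)) - (2 * m / N - 2) / (N - 2) = 1 / (m - 1)"
      using m
    proof
      assume "N = m"
      then show ?thesis using N by (simp add: field_simps)
    next
      assume "N = m + 1"
      then show ?thesis using N by (simp add: divide_simps)
    qed
    ultimately show ?thesis using True by simp
  next
    case False
    then have Nm: "N = m + 1" using fixed by blast
    have "j \<noteq> partner i"
    proof
      assume "j = partner i"
      then have "partner i \<noteq> i" "partner j \<noteq> j"
        using ij by simp_all
      with False show False by simp
    qed
    then have "\<kappa> = 0"
      by (simp add: \<kappa>_def)
    moreover have "r i + r j = 2 * m / N - 1"
    proof -
      consider "i \<in> paired" "j \<notin> paired" | "i \<notin> paired" "j \<in> paired"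
        using False unique_fixed[of i j] ij by blast
      then show ?thesis
        by cases (simp_all add: r_def)
    qed
    moreover have "m / (N * (N - 1)) - (2 * m / N - 1) / (N - 2) = 0"
      using N Nm by (simp add: divide_simps)
    ultimately show ?thesis using False by (simp only: if_False)
  qed
  finally show ?thesis by (simp add: m_def \<kappa>_def)
qed

lemma norm_Rm: "op_norm (metric x) (Rm metric x) = sqrt (real (card paired) / 2)"
proof -
  have "op_norm (metric x) (Rm metric x)
     = sqrt ((1/2) * (\<Sum>i\<in>UNIV. \<Sum>j\<in>UNIV. if i = j then 0 else (if j = partner i then - 1 else 0)\<^sup>2))"
    by (subst metric_def, rule op_norm_diagonal) (simp_all add: Rm_metric)
  also have "(\<Sum>i\<in>UNIV. \<Sum>j\<in>UNIV. if i = j then 0 else (if j = partner i then - 1 else (0::real))\<^sup>2)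
     = (\<Sum>i\<in>UNIV. if i \<in> paired then 1 else 0)"
  proof (rule sum.cong[OF refl])
    fix i
    have "(if i = j then 0 else (if j = partner i then - 1 else (0::real))\<^sup>2)
      = (if j = partner i then if i \<in> paired then 1 else 0 else 0)" for j
      by auto
    then show "(\<Sum>j\<in>UNIV. if i = j then 0 else (if j = partner i then - 1 else (0::real))\<^sup>2)
      = (if i \<in> paired then 1 else 0)"
      by simp
  qed
  also have "\<dots> = real (card paired)"
    by (simp add: sum.If_cases)
  finally show ?thesis by simp
qed

text \<open>
  For each paired \<open>i\<close>, the partner of \<open>i\<close> contributes \<open>(1/(m - 1) - 1)^2\<close> and the other \<open>m - 2\<close>
  paired indices contribute \<open>1/(m - 1)^2\<close> each; together this is \<open>(m - 2)/(m - 1)\<close>.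
\<close>

lemma norm_Weyl:
  assumes n: "CARD('n) \<ge> 4"
  shows "op_norm (metric x) (Weyl metric x)
    = sqrt (real (card paired) / 2 * ((real (card paired) - 2) / (real (card paired) - 1)))"
proof -
  define m where "m = real (card paired)"
  define t where "t i j = (if i = j then 0 else if i \<in> paired \<and> j \<in> paired
     then (if j = partner i then - 1 else 0) + 1 / (m - 1) else 0)" for i j
  have m: "m \<ge> 3"
    using card_paired n by (auto simp: m_def)
  have "op_norm (metric x) (Weyl metric x)
     = sqrt ((1/2) * (\<Sum>i\<in>UNIV. \<Sum>j\<in>UNIV. if i = j then 0 else (t i j)\<^sup>2))"
  proof (subst metric_def, rule op_norm_diagonal)
    show "Weyl metric x (wedge (axis i 1) (axis j 1)) = t i j *\<^sub>R wedge (axis i 1) (axis j 1)" for i j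
    proof (cases "i = j")
      case True
      \<comment> \<open>The bivector vanishes, and the Weyl operator is linear.\<close>
      then have "wedge (axis i 1) (axis j 1) = (0 :: real^'n^'n)"
        by (simp add: wedge_def vec_eq_iff)
      then show ?thesis
        by (simp add: Weyl_def Rm_def Rm_I_def Rm_Ric0_def vec_eq_iff matrix_matrix_mult_def)
    next
      case False
      then show ?thesis
        using Weyl_metric[OF n] by (simp add: t_def m_def)
    qed
  qed simp
  also have "(\<Sum>i\<in>UNIV. \<Sum>j\<in>UNIV. if i = j then 0 else (t i j)\<^sup>2)
     = (\<Sum>i\<in>UNIV. if i \<in> paired then (m - 2) / (m - 1) else 0)"
  proof (rule sum.cong[OF refl])
    fix i
    show "(\<Sum>j\<in>UNIV. if i = j then 0 else (t i j)\<^sup>2) = (if i \<in> paired then (m - 2) / (m - 1) else 0)"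
    proof (cases "i \<in> paired")
      case False
      then have "(if i = j then 0 else (t i j)\<^sup>2) = 0" for j
        by (simp add: t_def)
      with False show ?thesis by (simp only: sum.neutral_const if_False)
    next
      case True
      have sum_if: "(\<Sum>j\<in>UNIV. if j \<in> A then c else 0) = real (card A) * c" for A :: "'n set" and c
        by (simp add: sum.If_cases)
      have "(if i = j then 0 else (t i j)\<^sup>2)
          = (if j = partner i then (1 / (m - 1) - 1)\<^sup>2 else 0)
            + (if j \<in> paired - {i, partner i} then (1 / (m - 1))\<^sup>2 else 0)" for j
      proof -
        consider "j = i" | "j = partner i" | "j \<in> paired - {i, partner i}" | "j \<notin> paired"
          by blast
        then show ?thesis
        proof cases
          case 1
          with True show ?thesis by simp
        next
          case 2
          with True show ?thesis by (simp add: t_def)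
        next
          case 3
          then have "i \<noteq> j" "j \<noteq> partner i" by blast+
          moreover from this have "t i j = 1 / (m - 1)"
            using True 3 by (simp add: t_def)
          ultimately show ?thesis using 3 by simp
        next
          case 4
          then have "t i j = 0" "j \<noteq> partner i" "j \<notin> paired - {i, partner i}"
            using True by (auto simp: t_def)
          then show ?thesis by (simp only: if_False) simp
        qed
      qed
      then have "(\<Sum>j\<in>UNIV. if i = j then 0 else (t i j)\<^sup>2)
         = (1 / (m - 1) - 1)\<^sup>2 + real (card (paired - {i, partner i})) * (1 / (m - 1))\<^sup>2"
        by (simp only: sum.distrib sum_if) simp
      also have "real (card (paired - {i, partner i})) = m - 2"
      proof -
        have "card (paired - {i, partner i}) = card paired - card {i, partner i}"
          using True by (intro card_Diff_subset) auto
        moreover have "card {i, partner i} = 2"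
          using True by auto
        ultimately show ?thesis using m by (simp add: m_def)
      qed
      also have "(1 / (m - 1) - 1)\<^sup>2 + (m - 2) * (1 / (m - 1))\<^sup>2 = (m - 2) / (m - 1)"
        using m by (simp add: divide_simps power2_eq_square) (simp add: algebra_simps)
      finally show ?thesis using True by simp
    qed
  qed
  also have "\<dots> = m * ((m - 2) / (m - 1))"
    by (simp add: sum.If_cases m_def)
  finally show ?thesis by (simp add: m_def)
qed

lemma norm_Weyl_ge:
  assumes n: "CARD('n) \<ge> 4"
  shows "sqrt ((real CARD('n) - 4) / (real CARD('n) - 3)) * op_norm (metric x) (Rm metric x)
    \<le> op_norm (metric x) (Weyl metric x)"
proof -
  define m where "m = real (card paired)"
  have m: "real CARD('n) = m \<or> real CARD('n) = m + 1" "m \<ge> 3"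
    using card_paired n by (auto simp: m_def)
  have "(real CARD('n) - 4) / (real CARD('n) - 3) = 1 - 1 / (real CARD('n) - 3)"
    using n by (simp add: field_simps)
  also have "\<dots> \<le> 1 - 1 / (m - 1)"
    using m n by (auto intro!: divide_left_mono)
  also have "\<dots> = (m - 2) / (m - 1)"
    using m by (simp add: field_simps)
  finally have "(real CARD('n) - 4) / (real CARD('n) - 3) * (m / 2) \<le> m / 2 * ((m - 2) / (m - 1))"
    using m(2) by (subst mult.commute) (rule mult_left_mono; simp)
  then show ?thesis
    unfolding norm_Rm norm_Weyl[OF n] real_sqrt_mult[symmetric] m_def by (rule real_sqrt_le_mono)
qed

end

section \<open>Existence of the manifold\<close>

text \<open>
  After numbering the coordinates from \<open>0\<close>, each even number is paired with its successor and the
  odd numbers are the fibre coordinates. If there are oddly many coordinates, the last one has no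
  successor in range and is the only fixed point.
\<close>

lemma half_plane_product_exists:
  "\<exists>partner fibre. half_plane_product (partner :: 'n::finite \<Rightarrow> 'n) fibre"
proof -
  let ?n = "CARD('n)"
  obtain h :: "'n \<Rightarrow> nat" where h: "bij_betw h UNIV {0..<?n}"
    using ex_bij_betw_finite_nat[of "UNIV :: 'n set"] by auto
  define s where "s k = (if odd k then k - 1 else if k + 1 < ?n then k + 1 else k)" for k
  define partner where "partner i = inv h (s (h i))" for i
  have lt: "h i < ?n" for i
    using bij_betwE[OF h] by auto
  then have "s (h i) < ?n" for i
    using lt[of i] by (simp add: s_def less_imp_diff_less)
  then have hp: "h (partner i) = s (h i)" for i
    using h by (auto simp: partner_def bij_betw_def intro!: f_inv_into_f)
  have inj: "h i = h j \<longleftrightarrow> i = j" for i j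
    using h by (auto simp: bij_betw_def inj_eq)
  have "half_plane_product partner {i. odd (h i)}"
  proof
    show "partner (partner i) = i" for i
      unfolding inj[symmetric] hp using lt[of i] by (auto simp: s_def elim!: oddE)
    show "partner i \<notin> {i. odd (h i)}" if "i \<in> {i. odd (h i)}" for i
      using that by (auto simp: hp s_def)
    show "partner i \<in> {i. odd (h i)}" if "i \<notin> {i. odd (h i)}" "partner i \<noteq> i" for i
      using that unfolding inj[symmetric] mem_Collect_eq hp by (auto simp: s_def split: if_splits)
    show "i = j" if "partner i = i" "partner j = j" for i j
      using that lt[of i] lt[of j] unfolding inj[symmetric] hp
      by (auto simp: s_def split: if_splits elim!: oddE)
  qed
  then show ?thesis by blast
qed

theorem lemma6p1:
  assumes "CARD('n::finite) \<ge> 4"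
  shows "\<exists>M :: (real^'n, 'n) manifold_data.
    riemannian_manifold M \<and> homogeneous M \<and> \<not> flat M \<and>
    (\<forall>p\<in>points M. \<forall>c\<in>atlas M. p \<in> chart_dom c \<longrightarrow>
       (let G = metric_in M c; x = chart_map c p in
         op_norm (G x) (Weyl G x) \<ge>
           sqrt ((real CARD('n) - 4) / (real CARD('n) - 3)) * op_norm (G x) (Rm G x)))"
proof -
  obtain partner :: "'n \<Rightarrow> 'n" and fibre where "half_plane_product partner fibre"
    using half_plane_product_exists by blast
  then interpret half_plane_product partner fibre .
  have "paired \<noteq> {}"
  proof
    assume "paired = {}"
    then have "real (card paired) = 0"
      by (simp only: card.empty of_nat_0)
    then show False
      using card_paired assms by linarith
  qed
  then obtain i where "i \<in> paired"
    by blast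
  then have "\<not> flat half_plane_manifold"
    by (rule not_flat_half_planes)
  then show ?thesis
    using riemannian_manifold_half_planes homogeneous_half_planes norm_Weyl_ge[OF assms]
    by (intro exI[of _ half_plane_manifold]) (simp add: Let_def)
qed

end
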